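(* Let $\Phi$ be a signed digraph on $n\geq 2$ vertices whose Eisenstein eigenvalues $\lambda_1\geq\lambda_2\geq\cdots\geq\lambda_n$ satisfy $\lambda_2<0$. Then $\Phi$ is switching isomorphic to $K_n$ or to $K_n^*$.
   Context: Let $\omega=e^{i\pi/3}$ and $\mathbb{T}_6=\{\omega^k: k=0,\dots,5\}$. A signed digraph $\Phi=(G,\varphi)$ consists of a finite simple graph $G=(V,E)$ (the underlying graph $\Gamma(\Phi)$) and a map $\varphi$ assigning to every ordered pair $(u,v)$ of adjacent vertices a value $\varphi(u,v)\in\mathbb{T}_6$ with $\varphi(v,u)=\overline{\varphi(u,v)}$. Its Eisenstein matrix $\mathcal{E}(\Phi)$ is the Hermitian $V\times V$ matrix with $\mathcal{E}_{uv}=\varphi(u,v)$ if $u,v$ are adjacent and $0$ otherwise; the eigenvalues of $\Phi$ are those of $\mathcal{E}(\Phi)$, ordered $\lambda_1\geq\dots\geq\lambda_n$. A graph is regarded as the signed digraph with all gains $1$; in particular $K_n$ has $\mathcal{E}=J-I$. $K_n^*$ is the signed digraph whose Eisenstein matrix equals that of $K_n$ except for one pair of distinct vertices $u,v$ with $\mathcal{E}_{uv}=\omega$, $\mathcal{E}_{vu}=\overline{\omega}$. Two signed digraphs are switching isomorphic if one can be obtained from the other by a sequence of the operations: $\mathcal{E}\mapsto X\mathcal{E}X^{-1}$ with $X$ diagonal with diagonal entries in $\mathbb{T}_6$; relabeling the vertices ($\mathcal{E}\mapsto P\mathcal{E}P^\top$, $P$ a permutation matrix); taking the converse ($\mathcal{E}\mapsto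 \mathcal{E}^\top$). *)

theory Defs
  imports "HOL-Analysis.Analysis" "HOL-Computational_Algebra.Polynomial"
begin

definition omega :: complex where
  "omega = exp (\<i> * of_real pi / 3)"

definition T6 :: "complex set" where
  "T6 = {omega ^ k | k. k \<le> 5}"

text \<open>The vertex set is the whole (finite) type \<open>'v\<close>. Gains of non-adjacent pairs are irrelevant.\<close>

record 'v sdigraph =
  adj :: "'v \<Rightarrow> 'v \<Rightarrow> bool"
  gain :: "'v \<Rightarrow> 'v \<Rightarrow> complex"

definition signed_digraph :: "'v::finite sdigraph \<Rightarrow> bool" where
  "signed_digraph \<Phi> \<longleftrightarrow>
     irreflp (adj \<Phi>) \<and> symp (adj \<Phi>) \<and>
     (\<forall>u v. adj \<Phi> u v \<longrightarrow> gain \<Phi> u v \<in> T6 \<and> gain \<Phi> v u = cnj (gain \<Phi> u v))"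

definition eisenstein_matrix :: "'v::finite sdigraph \<Rightarrow> complex^'v^'v" where
  "eisenstein_matrix \<Phi> = (\<chi> u v. if adj \<Phi> u v then gain \<Phi> u v else 0)"

definition charpoly :: "complex^'v^'v \<Rightarrow> complex poly" where
  "charpoly A = det (\<chi> i j. (if i = j then [:0, 1:] else 0) - [:A $ i $ j:])"

text \<open>\<open>lam 1 \<ge> \<dots> \<ge> lam n\<close> are the eigenvalues of \<open>A\<close>, repeated according to multiplicity.
  Only the values of \<open>lam\<close> on \<open>{1..n}\<close> matter.\<close>

definition ordered_eigenvalues :: "complex^'v^'v \<Rightarrow> (nat \<Rightarrow> real) \<Rightarrow> bool" where
  "ordered_eigenvalues A lam \<longleftrightarrow>
     charpoly A = (\<Prod>k = 1..CARD('v). [:- complex_of_real (lam k), 1:]) \<and>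
     antimono_on {1..CARD('v)} lam"

definition of_graph :: "('v \<Rightarrow> 'v \<Rightarrow> bool) \<Rightarrow> 'v sdigraph" where
  "of_graph a = \<lparr>adj = a, gain = (\<lambda>_ _. 1)\<rparr>"

definition complete_sdigraph :: "'v sdigraph" where
  "complete_sdigraph = of_graph (\<noteq>)"

text \<open>The signed digraph \<open>K\<^sub>n\<^sup>*\<close>, with \<open>u \<noteq> v\<close> as the exceptional pair of vertices.\<close>

definition complete_star_sdigraph :: "'v \<Rightarrow> 'v \<Rightarrow> 'v sdigraph" where
  "complete_star_sdigraph u v = \<lparr>adj = (\<noteq>), gain = (\<lambda>x y.
     if x = u \<and> y = v then omega else if x = v \<and> y = u then cnj omega else 1)\<rparr>"

definition diag_matrix :: "('v \<Rightarrow> complex) \<Rightarrow> complex^'v^'v" where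
  "diag_matrix d = (\<chi> i j. if i = j then d i else 0)"

definition perm_matrix :: "('v \<Rightarrow> 'v) \<Rightarrow> complex^'v^'v" where
  "perm_matrix p = (\<chi> i j. if i = p j then 1 else 0)"

inductive switching_step :: "complex^'v^'v \<Rightarrow> complex^'v^'v \<Rightarrow> bool" where
  switch: "(\<And>v. d v \<in> T6) \<Longrightarrow>
     switching_step A (diag_matrix d ** A ** matrix_inv (diag_matrix d))"
| relabel: "bij p \<Longrightarrow> switching_step A (perm_matrix p ** A ** transpose (perm_matrix p))"
| converse: "switching_step A (transpose A)"

definition switching_isomorphic :: "'v::finite sdigraph \<Rightarrow> 'v sdigraph \<Rightarrow> bool" where
  "switching_isomorphic \<Phi> \<Psi> \<longleftrightarrow>
     switching_step\<^sup>*\<^sup>* (eisenstein_matrix \<Phi>) (eisenstein_matrix \<Psi>)"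

lemma omega_in_T6: "omega \<in> T6"
  unfolding T6_def by (auto intro!: exI[of _ 1])

lemma one_in_T6: "1 \<in> T6"
  unfolding T6_def by (auto intro!: exI[of _ 0])

lemma cnj_omega_in_T6: "cnj omega \<in> T6"
proof -
  have w: "omega = cis (pi / 3)"
    by (simp add: omega_def cis_conv_exp)
  have "omega ^ 5 = cis (5 * (pi / 3))"
    using Complex.DeMoivre[of "pi / 3" 5] by (simp add: w)
  also have "5 * (pi / 3) = - (pi / 3) + 2 * pi"
    by simp
  also have "cis (- (pi / 3) + 2 * pi) = cis (- (pi / 3))"
    by (simp only: cis_mult[symmetric] cis_2pi mult_1_right)
  finally have "cnj omega = omega ^ 5"
    by (simp add: w cis_cnj)
  then show ?thesis
    unfolding T6_def by auto
qed

lemma signed_digraph_complete: "signed_digraph complete_sdigraph"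
  by (auto simp: signed_digraph_def complete_sdigraph_def of_graph_def one_in_T6
      irreflp_def symp_def)

lemma signed_digraph_complete_star:
  "u \<noteq> v \<Longrightarrow> signed_digraph (complete_star_sdigraph u v)"
  by (auto simp: signed_digraph_def complete_star_sdigraph_def one_in_T6 omega_in_T6
      cnj_omega_in_T6 irreflp_def symp_def)

end

theory Submission imports Defs begin

text \<open>
  If \<open>\<lambda>\<^sub>2 < 0\<close>, the Hermitian form of the Eisenstein matrix is negative on every vector that is
  orthogonal, with respect to the form, to an independent isotropic vector: otherwise the Rayleigh
  principle would yield two orthogonal eigenvectors with nonnegative eigenvalues. Every unit vector
  is isotropic, so no two vertices are nonadjacent, and one can switch such that a chosen vertex
  \<open>r\<close> has all gains 1. Then the form is negative on all nonzero vectors on \<open>V - {r}\<close> with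
  coordinate sum zero. Test vectors with two to four nonzero coordinates show that the remaining
  gains lie in \<open>{1, \<omega>, \<omega>\<^sup>-\<^sup>1}\<close>, that the nontrivial ones, directed by \<open>\<omega>\<close>, contain neither a
  directed path of length two nor two disjoint edges, hence form a star, and that a star with at
  least two leaves covers \<open>V - {r}\<close>. In the latter case switching at the centre leaves the edge
  from the centre to \<open>r\<close> as the only nontrivial one.
\<close>

section \<open>Hermitian matrices with one nonnegative eigenvalue\<close>

lemma poly_det: "poly (det M) x = det (\<chi> i j. poly (M $ i $ j) x)"
  for M :: "'a::comm_ring_1 poly^'n^'n"
  by (simp add: det_def poly_sum poly_prod)

text \<open>Compactness gives a maximiser \<open>v\<close> of the form on the unit sphere of
  \<open>S\<close>. If \<open>w = l v - f v\<close> were nonzero, moving \<open>v\<close> slightly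
  along \<open>- w\<close> would raise the Rayleigh quotient above \<open>l\<close>. The invariant
  subspace allows a second application, on the orthogonal complement of a first eigenvector.\<close>

lemma selfadjoint_rayleigh_max:
  fixes f :: "'a::euclidean_space \<Rightarrow> 'a"
  assumes lin: "linear f" and sa: "\<And>x y. f x \<bullet> y = x \<bullet> f y"
    and S: "subspace S" "f ` S \<subseteq> S" "y0 \<in> S" "y0 \<noteq> 0"
  obtains v l where "v \<in> S" "norm v = 1" "f v = l *\<^sub>R v"
    "\<And>w. w \<in> S \<Longrightarrow> w \<bullet> f w \<le> l * (w \<bullet> w)"
proof -
  let ?K = "sphere 0 1 \<inter> S"
  have contf: "continuous_on UNIV f"
    using lin by (simp add: linear_continuous_on linear_conv_bounded_linear)
  have "compact ?K"
    by (intro compact_Int_closed compact_sphere closed_subspace S)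
  moreover have "(1 / norm y0) *\<^sub>R y0 \<in> ?K"
    using S by (simp add: subspace_scale)
  then have "?K \<noteq> {}" by blast
  moreover have "continuous_on ?K (\<lambda>x. x \<bullet> f x)"
    by (intro continuous_intros continuous_on_subset[OF contf]) auto
  ultimately obtain v where v: "v \<in> ?K" and max: "\<And>y. y \<in> ?K \<Longrightarrow> y \<bullet> f y \<le> v \<bullet> f v"
    using continuous_attains_sup by metis
  define l where "l = v \<bullet> f v"
  have vS: "v \<in> S" and nv: "norm v = 1" using v by auto
  have le: "w \<bullet> f w \<le> l * (w \<bullet> w)" if "w \<in> S" for w
  proof (cases "w = 0")
    case True then show ?thesis by simp
  next
    case False
    have "(1 / norm w) *\<^sub>R w \<in> ?K" using False that S by (simp add: subspace_scale)
    from max[OF this] have "(w \<bullet> f w) / (norm w)\<^sup>2 \<le> l"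
      by (simp add: l_def linear_scale[OF lin] power2_eq_square)
    then show ?thesis using False
      by (simp add: divide_le_eq power2_norm_eq_inner)
  qed
  define w where "w = l *\<^sub>R v - f v"
  have wS: "w \<in> S" unfolding w_def using S vS by (auto intro!: subspace_diff subspace_scale)
  have "w = 0"
  proof (rule ccontr)
    assume "w \<noteq> 0"
    define c where "c = l * (w \<bullet> w) - w \<bullet> f w"
    have c0: "c \<ge> 0" using le[OF wS] by (simp add: c_def)
    have ineq: "2 * t * (w \<bullet> w) + t\<^sup>2 * c \<ge> 0" for t :: real
    proof -
      have "v + t *\<^sub>R w \<in> S" using S vS wS by (auto intro!: subspace_add subspace_scale)
      from le[OF this] have "l + 2 * t * (v \<bullet> f w) + t\<^sup>2 * (w \<bullet> f w)
          \<le> l * (1 + 2 * t * (v \<bullet> w) + t\<^sup>2 * (w \<bullet> w))"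
        using nv sa[of v w] sa[of w v]
        by (simp add: linear_add[OF lin] linear_scale[OF lin] l_def inner_simps
            power2_eq_square algebra_simps inner_commute norm_eq_1)
      moreover have "2 * t * (w \<bullet> w) = 2 * t * (l * (v \<bullet> w)) - 2 * t * (v \<bullet> f w)"
        by (subst (1) w_def) (simp add: inner_simps sa right_diff_distrib)
      ultimately show ?thesis by (simp add: c_def distrib_left right_diff_distrib mult_ac)
    qed
    have ww: "w \<bullet> w > 0" using \<open>w \<noteq> 0\<close> by simp
    \<comment> \<open>For small negative \<open>t\<close> the linear term of \<open>ineq\<close>
      outweighs the quadratic one; the denominator \<open>c + 1\<close> stays positive even when
      \<open>c = 0\<close>.\<close>
    define t where "t = - (w \<bullet> w) / (c + 1)"
    have "t * c = - (w \<bullet> w) * (c / (c + 1))" by (simp add: t_def)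
    moreover have "(w \<bullet> w) * (c / (c + 1)) \<le> (w \<bullet> w) * 1"
      using c0 by (intro mult_left_mono) auto
    ultimately have "2 * (w \<bullet> w) + t * c > 0" using ww by linarith
    moreover have "t < 0" using c0 ww by (simp add: t_def)
    ultimately have "t * (2 * (w \<bullet> w) + t * c) < 0" by (rule mult_neg_pos[rotated])
    then show False using ineq[of t] by (simp add: power2_eq_square algebra_simps)
  qed
  then show ?thesis using that[of v l] vS nv le by (simp add: w_def)
qed

section \<open>Complex inner product and pairs of orthogonal eigenvectors\<close>

definition cinner :: "complex^'n \<Rightarrow> complex^'n \<Rightarrow> complex" where
  "cinner x y = (\<Sum>i\<in>UNIV. cnj (x $ i) * y $ i)"

text \<open>This link makes a Hermitian matrix self-adjoint as a real linear map, so that the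
  Rayleigh principle applies to it.\<close>

lemma Re_cinner: "Re (cinner x y) = x \<bullet> y"
  by (simp add: cinner_def inner_vec_def inner_complex_def)

lemma cinner_add_right: "cinner x (y + z) = cinner x y + cinner x z"
  by (simp add: cinner_def algebra_simps sum.distrib)

lemma cinner_diff_right: "cinner x (y - z) = cinner x y - cinner x z"
  by (simp add: cinner_def algebra_simps sum_subtractf)

lemma cinner_diff_left: "cinner (x - y) z = cinner x z - cinner y z"
  by (simp add: cinner_def algebra_simps sum_subtractf)

lemma cinner_scale_right: "cinner x (c *s y) = c * cinner x y"
  by (simp add: cinner_def sum_distrib_left mult_ac)

lemma cinner_scale_left: "cinner (c *s x) y = cnj c * cinner x y"
  by (simp add: cinner_def sum_distrib_left mult_ac)

lemma cnj_cinner: "cnj (cinner x y) = cinner y x"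
  by (simp add: cinner_def mult.commute)

lemma cinner_self_eq_0_iff: "cinner x x = 0 \<longleftrightarrow> x = 0"
proof
  assume "cinner x x = 0"
  then have "x \<bullet> x = 0" by (simp flip: Re_cinner)
  then show "x = 0" by simp
qed (simp add: cinner_def)

lemma cinner_hermitian:
  assumes "\<And>i j. A $ i $ j = cnj (A $ j $ i)"
  shows "cinner (A *v x) y = cinner x (A *v y)"
proof -
  have "cinner (A *v x) y = (\<Sum>i\<in>UNIV. \<Sum>j\<in>UNIV. cnj (x $ j) * (A $ j $ i * y $ i))"
    by (simp add: cinner_def matrix_vector_mult_def sum_distrib_right sum_distrib_left assms[symmetric] mult_ac)
  also have "\<dots> = (\<Sum>j\<in>UNIV. \<Sum>i\<in>UNIV. cnj (x $ j) * (A $ j $ i * y $ i))"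
    by (rule sum.swap)
  also have "\<dots> = cinner x (A *v y)"
    by (simp add: cinner_def matrix_vector_mult_def sum_distrib_left)
  finally show ?thesis .
qed

text \<open>
  Multiplying \<open>x I - A\<close> on the right by the identity matrix with two columns replaced by the
  eigenvectors makes the factors \<open>x - l\<close> and \<open>x - m\<close> split off; \<open>q\<close> is the
  determinant of that modified identity, a nonzero constant.
\<close>

lemma charpoly_two_eigenvectors:
  fixes A :: "complex^'n^'n"
  assumes ev: "A *v v = l *s v" "A *v w = m *s w" and "v \<noteq> 0" "w \<noteq> 0" "cinner v w = 0"
  obtains q R where "charpoly A * q = [:- l, 1:] * [:- m, 1:] * R" "\<And>x. poly q x \<noteq> 0"
proof -
  \<comment> \<open>Orthogonal nonzero vectors are independent, so some 2 by 2 minor of the pair is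
    nonzero. Its row indices name the columns of the identity that get replaced.\<close>
  obtain i j where minor: "v $ i * w $ j - v $ j * w $ i \<noteq> 0"
  proof (rule ccontr)
    assume "\<not> thesis"
    with that have eq: "v $ i * w $ j = v $ j * w $ i" for i j by auto
    obtain i where i: "v $ i \<noteq> 0" using \<open>v \<noteq> 0\<close> by (auto simp: vec_eq_iff)
    have "w = (w $ i / v $ i) *s v"
      using i eq[of i] by (simp add: vec_eq_iff field_simps)
    then have "(w $ i / v $ i) * cinner v v = 0"
      using \<open>cinner v w = 0\<close> cinner_scale_right by metis
    then show False using \<open>w \<noteq> 0\<close> \<open>w = _\<close> \<open>v \<noteq> 0\<close>
      by (auto simp: cinner_self_eq_0_iff)
  qed
  then have ij: "i \<noteq> j" by auto
  define Q :: "complex^'n^'n" where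
    "Q = (\<chi> k c. if c = i then v $ k else if c = j then w $ k else if k = c then 1 else 0)"
  define Qp where "Qp = (\<chi> k c. [:Q $ k $ c:])"
  define X :: "complex poly^'n^'n" where
    "X = (\<chi> i j. (if i = j then [:0, 1:] else 0) - [:A $ i $ j:])"
  \<comment> \<open>Columns \<open>i\<close> and \<open>j\<close> of \<open>X ** Qp\<close> are
    \<open>(x - l) v\<close> and \<open>(x - m) w\<close>; \<open>D\<close> collects the linear
    factors and \<open>R\<close> keeps the rest.\<close>
  define R :: "complex poly^'n^'n" where
    "R = (\<chi> k c. if c = i then [:v $ k:] else if c = j then [:w $ k:] else X $ k $ c)"
  define D :: "complex poly^'n^'n" where
    "D = (\<chi> k c. if k = c then (if c = i then [:- l, 1:] else if c = j then [:- m, 1:] else 1) else 0)"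
  have Qv: "(Q *v x) $ k = v $ k * x $ i + w $ k * x $ j + (if k = i \<or> k = j then 0 else x $ k)"
    for x k
  proof -
    have "(Q *v x) $ k = (\<Sum>c\<in>UNIV. (if c = i then v $ k * x $ i else 0)
        + (if c = j then w $ k * x $ j else 0)
        + (if c = k then (if k = i \<or> k = j then 0 else x $ k) else 0))"
      unfolding matrix_vector_mult_def Q_def using ij by (auto intro!: sum.cong)
    then show ?thesis by (simp add: sum.distrib)
  qed
  have "x = 0" if "Q *v x = 0" for x
  proof -
    have *: "v $ k * x $ i + w $ k * x $ j + (if k = i \<or> k = j then 0 else x $ k) = 0" for k
      using Qv[of x k] that by simp
    have "(v $ i * w $ j - v $ j * w $ i) * x $ i = 0" "(v $ i * w $ j - v $ j * w $ i) * x $ j = 0"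
      using *[of i] *[of j] by (simp_all, algebra+)
    then have "x $ i = 0" "x $ j = 0" using minor by auto
    then have "x $ k = 0" for k using *[of k] by (cases "k = i \<or> k = j") auto
    then show ?thesis by (simp add: vec_eq_iff)
  qed
  then have "det Q \<noteq> 0"
    by (metis matrix_left_invertible_ker invertible_left_inverse invertible_det_nz)
  then have q: "poly (det Qp) x \<noteq> 0" for x
    by (simp add: poly_det Qp_def)
  have evv: "(\<Sum>c\<in>UNIV. A $ k $ c * v $ c) = l * v $ k" "(\<Sum>c\<in>UNIV. A $ k $ c * w $ c) = m * w $ k" for k
    using ev by (simp_all add: vec_eq_iff matrix_vector_mult_def)
  have RD: "(R ** D) $ k $ c = R $ k $ c * D $ c $ c" for k c
  proof -
    have "(R ** D) $ k $ c = (\<Sum>d\<in>UNIV. if d = c then R $ k $ c * D $ c $ c else 0)"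
      unfolding matrix_matrix_mult_def vec_lambda_beta
      by (intro sum.cong refl) (simp add: D_def)
    then show ?thesis by simp
  qed
  have const: "(\<Sum>c\<in>UNIV. [:f c:]) = [:\<Sum>c\<in>UNIV. f c:]" for f :: "'n \<Rightarrow> complex"
    by (induction rule: infinite_finite_induct) auto
  have Xu: "(\<Sum>d\<in>UNIV. smult (u d) (X $ k $ d)) = [:0, u k:] - [:\<Sum>d\<in>UNIV. A $ k $ d * u d:]" for k u
  proof -
    have "(\<Sum>d\<in>UNIV. smult (u d) (X $ k $ d))
      = (\<Sum>d\<in>UNIV. (if d = k then [:0, u k:] else 0) - [:A $ k $ d * u d:])"
      by (intro sum.cong) (auto simp: X_def algebra_simps)
    then show ?thesis by (simp add: sum_subtractf const)
  qed
  have "X ** Qp = R ** D"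
  proof -
    have "(X ** Qp) $ k $ c = R $ k $ c * D $ c $ c" for k c
    proof -
      have 1: "(X ** Qp) $ k $ c = (\<Sum>d\<in>UNIV. X $ k $ d * [:Q $ d $ c:])"
        by (simp add: matrix_matrix_mult_def Qp_def)
      consider "c = i" | "c = j" | "c \<noteq> i" "c \<noteq> j" by blast
      then show ?thesis
      proof cases
        case 3
        then have "(\<Sum>d\<in>UNIV. X $ k $ d * [:Q $ d $ c:]) = (\<Sum>d\<in>UNIV. if d = c then X $ k $ c else 0)"
          by (intro sum.cong) (auto simp: Q_def)
        with 1 3 show ?thesis by (simp add: R_def D_def)
      qed (use 1 ij in \<open>auto simp: Xu evv Q_def R_def D_def mult.commute[of "_ $ _" "A $ _ $ _"]\<close>)
    qed
    then show ?thesis by (simp add: vec_eq_iff RD)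
  qed
  then have "det X * det Qp = det R * det D" by (metis det_mul)
  moreover have "det D = [:- l, 1:] * [:- m, 1:]"
  proof -
    have "det D = (\<Prod>c\<in>UNIV. (if c = i then [:- l, 1:] else 1) * (if c = j then [:- m, 1:] else 1))"
      using ij by (subst det_diagonal) (auto simp: D_def intro!: prod.cong)
    then show ?thesis by (simp add: prod.distrib)
  qed
  ultimately have "charpoly A * det Qp = [:- l, 1:] * [:- m, 1:] * det R"
    by (simp add: charpoly_def X_def mult_ac)
  then show ?thesis using q that by blast
qed

text \<open>If the form were nonnegative at \<open>y\<close>, it would be nonnegative on the complex
  plane spanned by \<open>x\<close> and \<open>y\<close>. This plane meets the orthogonal complement
  of a top eigenvector \<open>v\<close>, so the largest eigenvalue \<open>m\<close> on that
  complement is nonnegative too, and \<open>charpoly A\<close> has two nonnegative roots counted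
  with multiplicity.\<close>

lemma isotropic_pair_negative:
  fixes A :: "complex^'n^'n"
  assumes card: "CARD('n) \<ge> 2" and oe: "ordered_eigenvalues A lam" and neg: "lam 2 < 0"
    and herm: "\<And>i j. A $ i $ j = cnj (A $ j $ i)"
    and x: "cinner x (A *v x) = 0" and xy: "cinner x (A *v y) = 0"
    and indep: "\<And>c d. c *s x + d *s y = 0 \<Longrightarrow> c = 0 \<and> d = 0"
  shows "Re (cinner y (A *v y)) < 0"
proof (rule ccontr)
  assume "\<not> ?thesis"
  then have y: "Re (cinner y (A *v y)) \<ge> 0" by simp
  have lin: "linear ((*v) A)"
    by (auto intro!: linearI simp: vec_eq_iff matrix_vector_mult_def algebra_simps sum.distrib
        scaleR_sum_right)
  have sa: "(A *v x) \<bullet> y = x \<bullet> (A *v y)" for x y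
    using cinner_hermitian[OF herm, of x y] by (metis Re_cinner)
  have scR: "r *\<^sub>R u = complex_of_real r *s u" for r and u :: "complex^'n"
    by (simp add: vec_eq_iff) (simp add: scaleR_conv_of_real)
  have "x \<noteq> 0" using indep[of 1 0] by auto
  obtain v l where v: "norm v = 1" "A *v v = l *\<^sub>R v"
    and vmax: "\<And>w. w \<bullet> (A *v w) \<le> l * (w \<bullet> w)"
    using selfadjoint_rayleigh_max[OF lin sa subspace_UNIV _ _ \<open>x \<noteq> 0\<close>] by auto
  define S where "S = {u. cinner v u = 0}"
  have S: "subspace S"
    by (rule subspaceI) (simp_all add: S_def cinner_add_right scR cinner_scale_right, simp add: cinner_def)
  have AS: "(*v) A ` S \<subseteq> S"
    by (auto simp: S_def cinner_hermitian[OF herm, symmetric] v scR cinner_scale_left)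
  \<comment> \<open>A nonzero vector in the span of \<open>x\<close> and \<open>y\<close> that is
    orthogonal to \<open>v\<close>.\<close>
  define y0 where "y0 = (if cinner v x = 0 then x else cinner v y *s x - cinner v x *s y)"
  have y0: "y0 \<in> S" by (simp add: y0_def S_def cinner_diff_right cinner_scale_right)
  have "y0 \<noteq> 0" using \<open>x \<noteq> 0\<close> indep[of "cinner v y" "- cinner v x"] by (auto simp: y0_def)
  have yx: "cinner y (A *v x) = 0" using xy cinner_hermitian[OF herm] cnj_cinner
    by (metis complex_cnj_zero)
  have "y0 \<bullet> (A *v y0) \<ge> 0"
  proof (cases "cinner v x = 0")
    case True then show ?thesis using x by (simp add: y0_def flip: Re_cinner)
  next
    case False
    then have "cinner y0 (A *v y0) = cnj (cinner v x) * cinner v x * cinner y (A *v y)"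
      using x xy yx
      by (simp add: y0_def matrix_vector_mult_diff_distrib vector_scalar_commute
          cinner_diff_left cinner_diff_right cinner_scale_right cinner_scale_left)
    also have "\<dots> = complex_of_real ((cmod (cinner v x))\<^sup>2) * cinner y (A *v y)"
      by (metis complex_norm_square mult.commute)
    finally show ?thesis using y by (simp flip: Re_cinner)
  qed
  obtain w m where w: "w \<in> S" "norm w = 1" "A *v w = m *\<^sub>R w"
    and wmax: "\<And>u. u \<in> S \<Longrightarrow> u \<bullet> (A *v u) \<le> m * (u \<bullet> u)"
    using selfadjoint_rayleigh_max[OF lin sa S AS y0 \<open>y0 \<noteq> 0\<close>] by metis
  have "0 \<le> m * (y0 \<bullet> y0)" using wmax[OF y0] \<open>y0 \<bullet> (A *v y0) \<ge> 0\<close> by linarith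
  moreover have "y0 \<bullet> y0 > 0" using \<open>y0 \<noteq> 0\<close> by simp
  ultimately have m: "m \<ge> 0" by (simp add: zero_le_mult_iff)
  have "w \<bullet> w = 1" using w by (simp add: norm_eq_1)
  then have l: "l \<ge> 0" using vmax[of w] w m by simp
  obtain q R where qR: "charpoly A * q = [:- of_real l, 1:] * [:- of_real m, 1:] * R"
    and q: "\<And>x. poly q x \<noteq> 0"
  proof (rule charpoly_two_eigenvectors)
    show "A *v v = of_real l *s v" "A *v w = of_real m *s w" using v w by (simp_all add: scR)
    show "v \<noteq> 0" "w \<noteq> 0" "cinner v w = 0" using v w by (auto simp: S_def)
  qed (use that in blast)
  let ?P = "\<lambda>k. [:- complex_of_real (lam k), 1:]"
  have cp: "charpoly A = ?P 1 * (\<Prod>k=2..CARD('n). ?P k)"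
    using oe card unfolding ordered_eigenvalues_def
    by (simp add: prod.atLeast_Suc_atMost numeral_2_eq_2)
  have nz: "poly (\<Prod>k=2..CARD('n). ?P k) (of_real t) \<noteq> 0" if "t \<ge> 0" for t
  proof -
    have "lam k < 0" if "k \<in> {2..CARD('n)}" for k
    proof -
      have "lam k \<le> lam 2"
        using oe that card unfolding ordered_eigenvalues_def by (auto elim!: monotone_onD)
      then show ?thesis using neg by linarith
    qed
    then have "k \<in> {2..CARD('n)} \<Longrightarrow> t \<noteq> lam k" for k using that by fastforce
    then show ?thesis by (auto simp: poly_prod)
  qed
  \<comment> \<open>At nonnegative points only the factor of \<open>lam 1\<close> can vanish, so
    \<open>l = lam 1\<close>. Cancelling that factor before evaluating at \<open>m\<close> also
    covers the case \<open>l = m\<close>.\<close>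
  have "poly (charpoly A * q) (of_real l) = 0" unfolding qR by (simp only: poly_mult) simp
  then have "l = lam 1" using nz[OF l] q by (simp add: cp)
  then have "?P 1 * ((\<Prod>k=2..CARD('n). ?P k) * q) = ?P 1 * ([:- of_real m, 1:] * R)"
    using qR unfolding cp by (simp only: mult.assoc)
  then have "(\<Prod>k=2..CARD('n). ?P k) * q = [:- of_real m, 1:] * R"
    by (subst (asm) mult_cancel_left) auto
  then have "poly ((\<Prod>k=2..CARD('n). ?P k) * q) (of_real m) = 0"
    by (simp only: poly_mult) simp
  then show False using nz[OF m] q by simp
qed

section \<open>Sixth roots of unity and switching\<close>

lemma omega_Complex: "omega = Complex (1/2) (sqrt 3 / 2)"
proof -
  have "omega = cis (pi / 3)" by (simp add: omega_def cis_conv_exp)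
  then show ?thesis by (simp add: complex_eq_iff cos_60 sin_60)
qed

lemma omega_6: "omega ^ 6 = 1"
proof -
  have "omega ^ 3 = - 1"
    by (simp add: omega_Complex complex_eq_iff power3_eq_cube)
  then show ?thesis
    using power_mult[of omega 3 2] by simp
qed

lemma T6_mult: "x \<in> T6 \<Longrightarrow> y \<in> T6 \<Longrightarrow> x * y \<in> T6"
proof -
  assume "x \<in> T6" "y \<in> T6"
  then obtain i j where "x = omega ^ i" "y = omega ^ j" by (auto simp: T6_def)
  then have "x * y = omega ^ (6 * ((i + j) div 6) + (i + j) mod 6)"
    by (simp add: power_add)
  also have "\<dots> = omega ^ ((i + j) mod 6)"
    by (simp only: power_add power_mult omega_6 power_one mult_1_left)
  finally show ?thesis by (auto simp: T6_def intro!: exI[of _ "(i + j) mod 6"])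
qed

lemma T6_norm: "x \<in> T6 \<Longrightarrow> x * cnj x = 1"
proof -
  assume "x \<in> T6"
  then obtain i where "x = omega ^ i" by (auto simp: T6_def)
  moreover have "omega * cnj omega = 1"
    by (simp add: omega_Complex complex_eq_iff)
  ultimately show ?thesis by (simp flip: power_mult_distrib)
qed

lemma T6_Re_pos:
  assumes "x \<in> T6" "Re x > 0"
  shows "x \<in> {1, omega, cnj omega}"
proof -
  obtain k where k: "x = omega ^ k" "k \<le> 5" using assms by (auto simp: T6_def)
  have p: "omega ^ 2 = omega - 1" "omega ^ 3 = - 1" "omega ^ 4 = - omega" "omega ^ 5 = cnj omega"
    by (simp_all add: omega_Complex complex_eq_iff eval_nat_numeral)
  have "k \<in> {0, 1, 2, 3, 4, 5}" using k by auto
  then show ?thesis using k assms(2) p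
    by (auto simp: omega_Complex)
qed

text \<open>The two values differ only in the sign of \<open>y\<close>, and the later computations
  use only \<open>y * y = 3/4\<close>; one test vector thus serves both orientations.\<close>

lemma nontrivial_gain_Complex:
  assumes "z \<in> {omega, cnj omega}"
  obtains y where "z = Complex (1/2) y" "y * y = 3/4"
  using that[of "sqrt 3 / 2"] that[of "- (sqrt 3 / 2)"] assms
  by (auto simp: omega_Complex complex_eq_iff)

lemma nontrivial_gain_ne:
  assumes "z \<in> {omega, cnj omega}"
  shows "z \<noteq> 1" "z \<noteq> 0" "z \<noteq> cnj z" "cnj z \<noteq> 1"
  using assms by (auto simp: omega_Complex complex_eq_iff)

text \<open>Elements of \<open>T6\<close> have modulus 1, so the inverse of the diagonal matrix is
  its conjugate.\<close>

lemma switching_step_diag: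
  fixes A :: "complex^'v^'v"
  assumes "\<And>v. d v \<in> T6"
  shows "switching_step A (\<chi> u v. d u * A $ u $ v * cnj (d v))"
proof -
  have mult: "diag_matrix e ** B = (\<chi> i j. e i * B $ i $ j)" for e and B :: "complex^'v^'v"
  proof -
    have "(\<Sum>k\<in>UNIV. (if i = k then e i else 0) * B $ k $ j) = e i * B $ i $ j" for i j
      by (subst sum.cong[OF refl, of _ _ "\<lambda>k. if k = i then e i * B $ i $ j else 0"]) auto
    then show ?thesis by (simp add: vec_eq_iff matrix_matrix_mult_def diag_matrix_def)
  qed
  have mult': "B ** diag_matrix e = (\<chi> i j. B $ i $ j * e j)" for e and B :: "complex^'v^'v"
  proof -
    have "(\<Sum>k\<in>UNIV. B $ i $ k * (if k = j then e k else 0)) = B $ i $ j * e j" for i j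
      by (subst sum.cong[OF refl, of _ _ "\<lambda>k. if k = j then B $ i $ j * e j else 0"]) auto
    then show ?thesis by (simp add: vec_eq_iff matrix_matrix_mult_def diag_matrix_def)
  qed
  have inv: "diag_matrix d ** diag_matrix (\<lambda>v. cnj (d v)) = mat 1"
    "diag_matrix (\<lambda>v. cnj (d v)) ** diag_matrix d = mat 1"
    using T6_norm[OF assms]
    by (auto simp: mult) (auto simp: diag_matrix_def mat_def vec_eq_iff mult.commute)
  have "diag_matrix d ** matrix_inv (diag_matrix d) = mat 1"
    unfolding matrix_inv_def by (rule someI2) (use inv in auto)
  then have "matrix_inv (diag_matrix d) = diag_matrix (\<lambda>v. cnj (d v))"
    using inv(2) by (metis matrix_mul_assoc matrix_mul_lid matrix_mul_rid)
  then show ?thesis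
    using switch[of d A] assms by (simp add: mult mult')
qed

section \<open>Gains normalised at a root vertex\<close>

text \<open>Once all gains at \<open>r\<close> are 1, a vector supported off \<open>r\<close> is
  form-orthogonal to the unit vector of \<open>r\<close> exactly when its coordinates sum to 0;
  hence the shape of \<open>neg\<close>.\<close>

locale rooted_gain_matrix =
  fixes N :: "'v \<Rightarrow> 'v \<Rightarrow> complex" and r :: 'v
  assumes herm: "N u v = cnj (N v u)"
    and diag: "N u u = 0"
    and root: "u \<noteq> r \<Longrightarrow> N r u = 1"
    and T6: "u \<noteq> v \<Longrightarrow> N u v \<in> T6"
    and neg: "finite T \<Longrightarrow> r \<notin> T \<Longrightarrow> sum x T = 0 \<Longrightarrow> t \<in> T \<Longrightarrow> x t \<noteq> 0 \<Longrightarrow>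
      Re (\<Sum>u\<in>T. \<Sum>v\<in>T. cnj (x u) * N u v * x v) < 0"
begin

lemma Re_cnj_swap: "Re (cnj q * N b a * p) = Re (cnj p * N a b * q)"
  by (subst herm[of b a]) (simp add: algebra_simps)

text \<open>The vector with entries 1 at \<open>a\<close> and -1 at \<open>b\<close> has form value
  \<open>- 2 Re (N a b)\<close>.\<close>

lemma root_triangle_Re_pos:
  assumes "a \<noteq> r" "b \<noteq> r" "a \<noteq> b"
  shows "Re (N a b) > 0"
  using neg[of "{a, b}" "\<lambda>u. if u = a then 1 else -1" a] assms
    Re_cnj_swap[of "-1" b a 1] by (simp add: diag)

text \<open>The left side is half the form at \<open>(p, q, s)\<close>: the diagonal vanishes, and
  by \<open>Re_cnj_swap\<close> mirrored entries contribute equal real parts. \<open>neg4\<close> is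
  the analogue for four vertices.\<close>

lemma neg3:
  assumes "r \<notin> {a, b, c}" "distinct [a, b, c]" "p + q + s = 0" "p \<noteq> 0"
  shows "Re (cnj p * N a b * q + cnj p * N a c * s + cnj q * N b c * s) < 0"
proof -
  define x where "x = (\<lambda>u. if u = a then p else if u = b then q else s)"
  have x: "x a = p" "x b = q" "x c = s" using assms(2) by (auto simp: x_def)
  show ?thesis
    using neg[of "{a, b, c}" x a] assms x
      Re_cnj_swap[of q b a p] Re_cnj_swap[of s c a p] Re_cnj_swap[of s c b q]
    by (simp add: diag add.assoc del: times_complex.sel)
qed

lemma neg4:
  assumes "r \<notin> {a, b, c, d}" "distinct [a, b, c, d]" "p + q + s + t = 0" "p \<noteq> 0"
  shows "Re (cnj p * N a b * q + cnj p * N a c * s + cnj p * N a d * t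
    + cnj q * N b c * s + cnj q * N b d * t + cnj s * N c d * t) < 0"
proof -
  define x where "x = (\<lambda>u. if u = a then p else if u = b then q else if u = c then s else t)"
  have x: "x a = p" "x b = q" "x c = s" "x d = t" using assms(2) by (auto simp: x_def)
  show ?thesis
    using neg[of "{a, b, c, d}" x a] assms x
      Re_cnj_swap[of q b a p] Re_cnj_swap[of s c a p] Re_cnj_swap[of s c b q]
      Re_cnj_swap[of t d a p] Re_cnj_swap[of t d b q] Re_cnj_swap[of t d c s]
    by (simp add: diag add.assoc del: times_complex.sel)
qed

lemma gain_values:
  assumes "u \<noteq> v" shows "N u v \<in> {1, omega, cnj omega}"
proof (cases "u = r \<or> v = r")
  case True
  then show ?thesis using assms root herm by (metis complex_cnj_one insertI1)
next
  case False
  then show ?thesis using root_triangle_Re_pos T6_Re_pos T6 assms by blast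
qed

lemma gain_values':
  assumes "z \<in> {omega, cnj omega}" "u \<noteq> v" shows "N u v \<in> {1, z, cnj z}"
  using gain_values[of u v] assms by auto

lemma nontrivial_not_root:
  assumes "z \<in> {omega, cnj omega}" "N a b = z"
  shows "a \<noteq> r" "b \<noteq> r" "a \<noteq> b"
proof -
  note ne = nontrivial_gain_ne[OF assms(1)]
  show ab: "a \<noteq> b" using assms(2) ne diag by auto
  show "a \<noteq> r" using assms(2) ne root[of b] ab by auto
  show "b \<noteq> r" using assms(2) ne root[of a] ab herm[of a b] by auto
qed

text \<open>
  The test vectors below come from solving for the equality case: on vectors with sum zero the
  form equals \<open>- |x|\<^sup>2\<close> plus the form of \<open>N - (J - I)\<close>, whose nonzero entries are the
  cube roots of unity \<open>z - 1 = z\<^sup>2\<close>.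
\<close>

lemma no_directed_path:
  assumes z: "z \<in> {omega, cnj omega}" and e: "N a b = z" "N b c = z"
  shows False
proof -
  \<comment> \<open>With \<open>c = a\<close> the value \<open>z\<close> would equal its own
    conjugate.\<close>
  have ac: "a \<noteq> c" using e herm[of b a] nontrivial_gain_ne[OF z] by auto
  have d: "r \<notin> {a, b, c}" "distinct [a, b, c]"
    using nontrivial_not_root[OF z e(1)] nontrivial_not_root[OF z e(2)] ac by auto
  obtain y where y: "z = Complex (1/2) y" "y * y = 3/4" using nontrivial_gain_Complex[OF z] .
  have v: "N a c \<in> {1, z, cnj z}" using gain_values'[OF z ac] .
  \<comment> \<open>Since \<open>z * z = z - 1\<close>, the left side is the real part of
    \<open>cnj z * (2 - N a c)\<close>, which is 1/2, 0 or 3/2 for \<open>N a c\<close> equal to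
    \<open>1\<close>, \<open>z\<close> or \<open>cnj z\<close>.\<close>
  have "Re (cnj (z - 1) * N a b * 1 + cnj (z - 1) * N a c * (- z) + cnj 1 * N b c * (- z)) < 0"
    by (rule neg3[OF d]) (use nontrivial_gain_ne[OF z] in auto)
  then show False using v e y(2) by (auto simp: y(1) algebra_simps)
qed

text \<open>Excluding directed paths fixes \<open>N a c\<close> and \<open>N b d\<close> at 1 and
  leaves only \<open>a\<close> to \<open>d\<close> and \<open>c\<close> to \<open>b\<close> as
  possible further edges. Each of the four resulting cases has its own test vector.\<close>

lemma no_matching:
  assumes z: "z \<in> {omega, cnj omega}" and e: "N a b = z" "N c d = z" and dist: "distinct [a, b, c, d]"
  shows False
proof -
  have r: "r \<notin> {a, b, c, d}"
    using nontrivial_not_root[OF z e(1)] nontrivial_not_root[OF z e(2)] by auto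
  have rev: "N v u = z" if "N u v = cnj z" for u v using herm[of v u] that by simp
  note path = no_directed_path[OF z]
  have ac: "N a c = 1"
    using gain_values'[OF z, of a c] dist path[of a c d] path[of c a b] e rev[of a c] by auto
  have bd: "N b d = 1"
    using gain_values'[OF z, of b d] dist path[of a b d] path[of c d b] e rev[of b d] by auto
  have cb: "N a d \<in> {1, z}" "N c b \<in> {1, z}"
    using gain_values'[OF z, of a d] gain_values'[OF z, of c b] dist
      path[of d a b] path[of a b c] e rev[of a d] rev[of c b] by auto
  have bc: "N b c = cnj (N c b)" by (rule herm)
  obtain y where y: "z = Complex (1/2) y" "y * y = 3/4" using nontrivial_gain_Complex[OF z] .
  have yy: "y * (y * k) = 3/4 * k" for k using y(2) by (metis mult.assoc)
  note n = neg4[OF r dist]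
  note s = e ac bd bc y yy algebra_simps
  \<comment> \<open>The form vanishes at every vector used here. By \<open>z * z = z - 1\<close>,
    those of the last two cases have the shape \<open>(p, - p, s, - s)\<close> with \<open>p\<close>
    and \<open>s\<close> being \<open>2 - z\<close> and \<open>1 + z\<close> in some order.\<close>
  consider "N a d = 1" "N c b = 1" | "N a d = z" "N c b = z"
    | "N a d = z" "N c b = 1" | "N a d = 1" "N c b = z" using cb by auto
  then show False
  proof cases
    case 1
    then show ?thesis using n[of 1 "- z" "- 1" z] by (simp add: s)
  next
    case 2
    then show ?thesis using n[of 1 "- 1" 1 "- 1"] by (simp add: s)
  next
    case 3
    then show ?thesis using n[of "2 - z" "z * (2 * z - 1)" "1 + z" "- z * (2 - z)"]
      by (simp add: s complex_eq_iff)
  next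
    case 4
    then show ?thesis using n[of "1 + z" "- z * (2 - z)" "2 - z" "z * (2 * z - 1)"]
      by (simp add: s complex_eq_iff)
  qed
qed

text \<open>The form vanishes at the test vector. Consequently a star with two leaves must reach
  every vertex other than its centre and \<open>r\<close>.\<close>

lemma no_partial_star:
  assumes z: "z \<in> {omega, cnj omega}" and e: "N c a = z" "N c b = z" "N c m = 1"
    and dist: "distinct [c, a, b, m]" and m: "m \<noteq> r"
    and others: "N a b = 1" "N a m = 1" "N b m = 1"
  shows False
proof -
  have r: "r \<notin> {c, a, b, m}"
    using nontrivial_not_root[OF z e(1)] nontrivial_not_root[OF z e(2)] m by auto
  obtain y where y: "z = Complex (1/2) y" "y * y = 3/4" using nontrivial_gain_Complex[OF z] .
  show False using neg4[OF r dist, of 3 "- z - 1" "- z - 1" "2 * z - 1"]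
    by (simp add: e others y algebra_simps complex_eq_iff)
qed

text \<open>Direct edges by \<open>omega\<close> and fix one, from \<open>a\<close> to
  \<open>b\<close>. By the two exclusions every edge starts at \<open>a\<close> or ends at
  \<open>b\<close>. A second edge into \<open>b\<close> rules out a second edge out of
  \<open>a\<close>, so all edges share an end; \<open>z\<close> records whether they leave the
  centre or enter it.\<close>

lemma star_structure:
  assumes e: "N a b \<noteq> 1" "a \<noteq> b"
  obtains c l z where "z \<in> {omega, cnj omega}" "N c l = z"
    "\<And>u v. u \<noteq> v \<Longrightarrow> c \<notin> {u, v} \<Longrightarrow> N u v = 1"
    "\<And>u. u \<noteq> c \<Longrightarrow> N c u \<in> {1, z}"
proof -
  let ?z = omega
  have ne: "omega \<in> {omega, cnj omega}" "cnj omega \<in> {omega, cnj omega}" by auto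
  have rev: "N v u = ?z" if "N u v = cnj ?z" for u v using herm[of v u] that by simp
  obtain a b where ab: "N a b = ?z" using gain_values[OF e(2)] e(1) rev by blast
  have a_ne_b: "a \<noteq> b" using nontrivial_not_root[OF ne(1) ab] by simp
  have meet: "u = a \<or> v = b" if uv: "N u v = ?z" for u v
  proof (rule ccontr)
    assume "\<not> ?thesis"
    moreover have "u \<noteq> v" using nontrivial_not_root[OF ne(1) uv] by simp
    moreover have "u \<noteq> b" "v \<noteq> a" using no_directed_path[OF ne(1)] ab uv by blast+
    ultimately have "distinct [a, b, u, v]" using a_ne_b by auto
    then show False using no_matching[OF ne(1) ab uv] by blast
  qed
  have one: "N u v = 1" if "u \<noteq> v" "N u v \<noteq> ?z" "N v u \<noteq> ?z" for u v
    using gain_values[OF that(1)] rev that by blast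
  show ?thesis
  proof (cases "\<exists>y. N y b = ?z \<and> y \<noteq> a")
    case False
    show ?thesis
    proof (rule that[of ?z a b])
      show "N u v = 1" if "u \<noteq> v" "a \<notin> {u, v}" for u v
        using one[OF that(1)] meet[of u v] meet[of v u] that False by auto
      show "N a u \<in> {1, ?z}" if "u \<noteq> a" for u
        using gain_values[of a u] that rev[of a u] no_directed_path[OF ne(1), of u a b] ab by auto
    qed (use ab in auto)
  next
    case True
    then obtain y where y: "N y b = ?z" "y \<noteq> a" by blast
    have only: "x = b" if "N a x = ?z" for x
    proof (rule ccontr)
      assume "x \<noteq> b"
      moreover have "x \<noteq> y" using no_directed_path[OF ne(1)] that y by blast
      moreover have "y \<noteq> b" "x \<noteq> a"
        using nontrivial_not_root[OF ne(1) y(1)] nontrivial_not_root[OF ne(1) that] by auto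
      ultimately have "distinct [a, x, y, b]" using y(2) a_ne_b by auto
      then show False using no_matching[OF ne(1) that y(1)] by blast
    qed
    show ?thesis
    proof (rule that[of "cnj ?z" b a])
      show "N b a = cnj ?z" using herm[of b a] ab by simp
      show "N u v = 1" if "u \<noteq> v" "b \<notin> {u, v}" for u v
        using one[OF that(1)] meet[of u v] meet[of v u] that only by auto
      show "N b u \<in> {1, cnj ?z}" if "u \<noteq> b" for u
        using gain_values[of b u] that no_directed_path[OF ne(1), of a b u] ab by auto
    qed auto
  qed
qed

end

section \<open>Switching to the two normal forms\<close>

lemma switching_isomorphic_star:
  fixes \<Phi> :: "'v::finite sdigraph"
  assumes st: "switching_step\<^sup>*\<^sup>* (eisenstein_matrix \<Phi>) (\<chi> u v. M u v)"
    and z: "z \<in> {omega, cnj omega}" and "c \<noteq> l"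
    and M: "M c l = z" "M l c = cnj z" "\<And>u. M u u = 0"
      "\<And>u v. u \<noteq> v \<Longrightarrow> {u, v} \<noteq> {c, l} \<Longrightarrow> M u v = 1"
  shows "\<exists>u v. u \<noteq> v \<and> switching_isomorphic \<Phi> (complete_star_sdigraph u v)"
proof -
  have eq: "(\<chi> u v. M u v) = eisenstein_matrix (complete_star_sdigraph c' l')"
    if "{c', l'} = {c, l}" "M c' l' = omega" "M l' c' = cnj omega" for c' l'
  proof -
    have "M u v = (if u \<noteq> v then if u = c' \<and> v = l' then omega
        else if u = l' \<and> v = c' then cnj omega else 1 else 0)" for u v
    proof -
      consider "u = v" | "u = c'" "v = l'" | "u = l'" "v = c'" | "u \<noteq> v" "{u, v} \<noteq> {c', l'}"
        by (auto simp: doubleton_eq_iff)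
      then show ?thesis
      proof cases
        case 1
        then show ?thesis using M(3)[of u] by simp
      next
        case 2
        then show ?thesis using that(2) M(3)[of u] by auto
      next
        case 3
        then show ?thesis using that(2,3) M(3)[of u] by auto
      next
        case 4
        then have "M u v = 1" using M(4)[of u v] that(1) by simp
        then show ?thesis using 4 by (auto simp: doubleton_eq_iff)
      qed
    qed
    then show ?thesis
      by (simp add: vec_eq_iff eisenstein_matrix_def complete_star_sdigraph_def)
  qed
  show ?thesis
  proof (cases "z = omega")
    case True
    then show ?thesis using st eq[of c l] M \<open>c \<noteq> l\<close> unfolding switching_isomorphic_def by metis
  next
    case False
    \<comment> \<open>Swapping the exceptional pair conjugates its gain.\<close>
    then have "z = cnj omega" using z by simp
    then show ?thesis using st eq[of l c] M \<open>c \<noteq> l\<close> unfolding switching_isomorphic_def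
      by (metis complex_cnj_cnj insert_commute)
  qed
qed

theorem theorem5p4:
  fixes \<Phi> :: "'v::finite sdigraph" and lam :: "nat \<Rightarrow> real"
  assumes "signed_digraph \<Phi>"
    and "CARD('v) \<ge> 2"
    and "ordered_eigenvalues (eisenstein_matrix \<Phi>) lam"
    and "lam 2 < 0"
  shows "switching_isomorphic \<Phi> complete_sdigraph \<or>
         (\<exists>u v. u \<noteq> v \<and> switching_isomorphic \<Phi> (complete_star_sdigraph u v))"
proof -
  define A where "A = eisenstein_matrix \<Phi>"
  have irr: "\<not> adj \<Phi> u u" and sym: "adj \<Phi> u v \<longleftrightarrow> adj \<Phi> v u"
    and gT6: "adj \<Phi> u v \<Longrightarrow> gain \<Phi> u v \<in> T6"
    and gcnj: "adj \<Phi> v u \<Longrightarrow> gain \<Phi> u v = cnj (gain \<Phi> v u)" for u v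
    using assms(1) unfolding signed_digraph_def by (blast dest: irreflpD sympD)+
  have A: "A $ u $ v = (if adj \<Phi> u v then gain \<Phi> u v else 0)" for u v
    by (simp add: A_def eisenstein_matrix_def)
  have herm: "A $ u $ v = cnj (A $ v $ u)" for u v
    using gcnj[of v u] sym[of u v] by (simp add: A)
  have diag: "A $ u $ u = 0" for u by (simp add: A irr)
  have T6_or_0: "A $ u $ v \<in> T6 \<or> A $ u $ v = 0" for u v by (simp add: A gT6)
  note isotropic = isotropic_pair_negative[OF assms(2) assms(3)[folded A_def] assms(4) herm]
  have Aaxis: "A *v axis v 1 = (\<chi> u. A $ u $ v)" for v
  proof -
    have "(\<Sum>i\<in>UNIV. A $ u $ i * axis v 1 $ i) = (\<Sum>i\<in>UNIV. if i = v then A $ u $ v else 0)" for u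
      by (intro sum.cong) (auto simp: axis_def)
    then show ?thesis by (simp add: vec_eq_iff matrix_vector_mult_def)
  qed
  have cinner_axis: "cinner (axis u 1) x = x $ u" for u and x :: "complex^'v"
  proof -
    have "cinner (axis u 1) x = (\<Sum>i\<in>UNIV. if i = u then x $ u else 0)"
      unfolding cinner_def by (intro sum.cong) (auto simp: axis_def)
    then show ?thesis by simp
  qed
  \<comment> \<open>For nonadjacent vertices the two unit vectors are isotropic and form-orthogonal,
    so the form would have to be negative at the second one.\<close>
  have T6: "A $ u $ v \<in> T6" if "u \<noteq> v" for u v
  proof (rule ccontr)
    assume "A $ u $ v \<notin> T6"
    then have "A $ u $ v = 0" using T6_or_0 by blast
    moreover have "c = 0 \<and> d = 0" if eq: "c *s axis u 1 + d *s axis v 1 = (0 :: complex^'v)" for c d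
    proof -
      have "(c *s axis u 1 + d *s axis v 1) $ u = (0 :: complex)"
        "(c *s axis u 1 + d *s axis v 1) $ v = (0 :: complex)"
        unfolding eq by simp_all
      then show ?thesis using \<open>u \<noteq> v\<close> by (simp add: axis_def)
    qed
    ultimately show False
      using isotropic[of "axis u 1" "axis v 1"] by (simp add: Aaxis cinner_axis diag)
  qed
  \<comment> \<open>An arbitrary vertex serves as the root; \<open>d\<close> then turns each gain
    \<open>A $ r $ u\<close> into 1.\<close>
  define r :: 'v where "r = undefined"
  define d where "d u = (if u = r then 1 else A $ r $ u)" for u
  define N where "N u v = d u * A $ u $ v * cnj (d v)" for u v
  have dT6: "d u \<in> T6" for u using T6[of r u] one_in_T6 by (auto simp: d_def)
  have dnz: "d u \<noteq> 0" for u using T6_norm[OF dT6[of u]] by auto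
  have step: "switching_step A (\<chi> u v. N u v)"
    unfolding N_def by (rule switching_step_diag[OF dT6])
  interpret G: rooted_gain_matrix N r
  proof
    fix u v
    show "N u v = cnj (N v u)" by (simp add: N_def herm[of u v] mult_ac)
    show "N u u = 0" by (simp add: N_def diag)
    show "u \<noteq> r \<Longrightarrow> N r u = 1" using T6_norm[OF T6[of r u]] by (simp add: N_def d_def)
    have "cnj (d v) \<in> T6" using T6[of v r] herm[of v r] one_in_T6 by (auto simp: d_def)
    then show "u \<noteq> v \<Longrightarrow> N u v \<in> T6" unfolding N_def by (intro T6_mult dT6 T6)
  next
    fix T and x :: "'v \<Rightarrow> complex" and t
    assume T: "finite T" "r \<notin> T" "sum x T = 0" "t \<in> T" "x t \<noteq> 0"
    \<comment> \<open>Undoing the switching turns the form of \<open>N\<close> at \<open>x\<close>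
      into the form of \<open>A\<close> at \<open>y\<close>, and the coordinate sum of
      \<open>x\<close> into entry \<open>r\<close> of \<open>A *v y\<close>.\<close>
    define y where "y = (\<chi> u. if u \<in> T then cnj (d u) * x u else 0)"
    have sumT: "(\<Sum>u\<in>UNIV. if u \<in> T then f u else 0) = sum f T" for f :: "'v \<Rightarrow> complex"
      by (simp add: sum.If_cases)
    have Ay: "(A *v y) $ u = (\<Sum>v\<in>T. A $ u $ v * cnj (d v) * x v)" for u
    proof -
      have "(A *v y) $ u = (\<Sum>v\<in>UNIV. if v \<in> T then A $ u $ v * cnj (d v) * x v else 0)"
        unfolding matrix_vector_mult_def y_def by (auto intro!: sum.cong)
      then show ?thesis by (simp only: sumT)
    qed
    have "(A *v y) $ r = (\<Sum>v\<in>T. x v)" unfolding Ay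
    proof (intro sum.cong refl)
      fix v assume "v \<in> T"
      then have "v \<noteq> r" using T by auto
      then show "A $ r $ v * cnj (d v) * x v = x v"
        using T6_norm[OF T6[of r v]] by (simp add: d_def)
    qed
    then have "cinner (axis r 1) (A *v y) = 0" using T by (simp add: cinner_axis)
    moreover have "c = 0 \<and> e = 0" if eq: "c *s axis r 1 + e *s y = 0" for c e
    proof -
      have "(c *s axis r 1 + e *s y) $ r = 0" "(c *s axis r 1 + e *s y) $ t = 0"
        unfolding eq by simp_all
      then show ?thesis using T dnz[of t] by (auto simp: axis_def y_def)
    qed
    ultimately have "Re (cinner y (A *v y)) < 0"
      by (intro isotropic[of "axis r 1" y]) (simp_all add: Aaxis cinner_axis diag)
    also have "cinner y (A *v y) = (\<Sum>u\<in>UNIV. if u \<in> T then cnj (x u) * d u * (A *v y) $ u else 0)"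
      unfolding cinner_def by (intro sum.cong) (auto simp: y_def)
    also have "\<dots> = (\<Sum>u\<in>T. cnj (x u) * d u * (A *v y) $ u)" by (rule sumT)
    also have "\<dots> = (\<Sum>u\<in>T. \<Sum>v\<in>T. cnj (x u) * N u v * x v)"
      by (simp add: Ay N_def sum_distrib_left mult.assoc)
    finally show "Re (\<Sum>u\<in>T. \<Sum>v\<in>T. cnj (x u) * N u v * x v) < 0" .
  qed
  show ?thesis
  proof (cases "\<exists>a b. a \<noteq> b \<and> N a b \<noteq> 1")
    case False
    then have "(\<chi> u v. N u v) = eisenstein_matrix complete_sdigraph"
      by (auto simp: vec_eq_iff eisenstein_matrix_def complete_sdigraph_def of_graph_def G.diag)
    then show ?thesis using step unfolding switching_isomorphic_def A_def by auto
  next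
    case True
    then obtain c l z where z: "z \<in> {omega, cnj omega}" and cl: "N c l = z"
      and off: "\<And>u v. u \<noteq> v \<Longrightarrow> c \<notin> {u, v} \<Longrightarrow> N u v = 1"
      and on: "\<And>u. u \<noteq> c \<Longrightarrow> N c u \<in> {1, z}"
      using G.star_structure by metis
    have c: "c \<noteq> r" "l \<noteq> r" "c \<noteq> l" using G.nontrivial_not_root[OF z cl] by auto
    show ?thesis
    proof (cases "\<exists>b. b \<noteq> l \<and> N c b = z")
      case False
      have "\<exists>u v. u \<noteq> v \<and> switching_isomorphic \<Phi> (complete_star_sdigraph u v)"
      proof (rule switching_isomorphic_star[where M = N and c = c and l = l and z = z])
        show "switching_step\<^sup>*\<^sup>* (eisenstein_matrix \<Phi>) (\<chi> u v. N u v)" using step by (simp add: A_def)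
        show "z \<in> {omega, cnj omega}" "c \<noteq> l" "N c l = z" by fact+
        show "N l c = cnj z" using G.herm[of l c] cl by simp
        show "N u v = 1" if "u \<noteq> v" "{u, v} \<noteq> {c, l}" for u v
        proof -
          have one: "N c x = 1" if "x \<noteq> c" "x \<noteq> l" for x using on[of x] False that by blast
          consider "u = c" "v \<noteq> l" | "v = c" "u \<noteq> l" | "c \<notin> {u, v}"
            using \<open>{u, v} \<noteq> {c, l}\<close> by blast
          then show ?thesis
          proof cases
            case 1
            then show ?thesis using one[of v] \<open>u \<noteq> v\<close> by auto
          next
            case 2
            then show ?thesis using one[of u] \<open>u \<noteq> v\<close> G.herm[of u v] by auto
          next
            case 3
            then show ?thesis using off \<open>u \<noteq> v\<close> by blast
          qed
        qed
      qed (rule G.diag)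
      then show ?thesis ..
    next
      case True
      then obtain b where b: "b \<noteq> l" "N c b = z" by blast
      have full: "N c m = z" if "m \<noteq> c" "m \<noteq> r" for m
      proof (rule ccontr)
        assume m: "N c m \<noteq> z"
        then have "N c m = 1" using on that by auto
        moreover have "distinct [c, l, b, m]"
          using m cl b c that G.nontrivial_not_root[OF z b(2)] by auto
        ultimately show False
          using G.no_partial_star[OF z cl b(2), of m] that off by auto
      qed
      \<comment> \<open>All gains from \<open>c\<close> are \<open>z\<close> except the gain 1 to
        \<open>r\<close>. Multiplying row \<open>c\<close> by \<open>cnj z\<close> makes the former
        1 and leaves the pair of \<open>r\<close> and \<open>c\<close> as the exceptional
        one.\<close>
      define e where "e v = (if v = c then cnj z else 1)" for v
      have eT6: "e v \<in> T6" for v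
        using z by (auto simp: e_def one_in_T6 omega_in_T6 cnj_omega_in_T6)
      define M where "M u v = e u * N u v * cnj (e v)" for u v
      have "switching_step (\<chi> u v. N u v) (\<chi> u v. M u v)"
        using switching_step_diag[OF eT6, of "\<chi> u v. N u v"] by (simp add: M_def)
      with step have st: "switching_step\<^sup>*\<^sup>* (eisenstein_matrix \<Phi>) (\<chi> u v. M u v)"
        unfolding A_def by (meson converse_rtranclp_into_rtranclp rtranclp.rtrancl_refl)
      have zz: "z * cnj z = 1" using z by (intro T6_norm) (auto simp: omega_in_T6 cnj_omega_in_T6)
      have Nr: "N r c = 1" "N c r = 1" using G.root[OF c(1)] G.herm[of c r] by auto
      have "\<exists>u v. u \<noteq> v \<and> switching_isomorphic \<Phi> (complete_star_sdigraph u v)"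
      proof (rule switching_isomorphic_star[where M = M and c = r and l = c, OF st z])
        show "r \<noteq> c" using c by simp
        show "M r c = z" "M c r = cnj z" using c by (simp_all add: M_def e_def Nr)
        show "M u u = 0" for u by (simp add: M_def G.diag)
        show "M u v = 1" if "u \<noteq> v" "{u, v} \<noteq> {r, c}" for u v
        proof -
          consider "u = c" "v \<noteq> r" | "v = c" "u \<noteq> r" | "c \<notin> {u, v}"
            using \<open>{u, v} \<noteq> {r, c}\<close> by blast
          then show ?thesis
          proof cases
            case 1
            then show ?thesis using full[of v] \<open>u \<noteq> v\<close> zz by (simp add: M_def e_def mult.commute)
          next
            case 2
            then show ?thesis using full[of u] \<open>u \<noteq> v\<close> G.herm[of u v] zz
              by (simp add: M_def e_def mult.commute)
          next
            case 3
            then show ?thesis using off[of u v] \<open>u \<noteq> v\<close> by (auto simp: M_def e_def)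
          qed
        qed
      qed
      then show ?thesis ..
    qed
  qed
qed

end
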